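(* Let $a_0,\dots,a_7$ be real numbers with $a_0+na_1+a_2+a_3+a_5+a_6\neq0$, and let $M$ be an $n$-dimensional $(R,S_{\mathcal{T}_a})$-semisymmetric $(N(k),\xi)$-semi-Riemannian manifold. Then $S(X,Y)=k(n-1)g(X,Y)$ for all vector fields $X,Y$.
   Context: Let $(M,g)$ be an $n$-dimensional semi-Riemannian manifold with curvature tensor $R$, Ricci tensor $S$ (with $S(Y,Z)$ the trace of $X\mapsto R(X,Y)Z$), Ricci operator $Q$ ($g(QX,Y)=S(X,Y)$) and scalar curvature $r$. For real numbers $a_0,\dots,a_7$, the $\mathcal{T}_a$-curvature tensor is $$\mathcal{T}_a(X,Y)Z=a_0R(X,Y)Z+a_1S(Y,Z)X+a_2S(X,Z)Y+a_3S(X,Y)Z+a_4g(Y,Z)QX+a_5g(X,Z)QY+a_6g(X,Y)QZ+a_7r\,(g(Y,Z)X-g(X,Z)Y),$$ and its Ricci-type contraction is $$S_{\mathcal{T}_a}(X,Y)=(a_0+na_1+a_2+a_3+a_5+a_6)S(X,Y)+(a_4+(n-1)a_7)r\,g(X,Y).$$ For a real number $k$, the $k$-nullity distribution is $N(k):p\mapsto\{Z\in T_pM: R(X,Y)Z=k(g(Y,Z)X-g(X,Z)Y)\text{ for all }X,Y\in T_pM\}$. An $(N(k),\xi)$-semi-Riemannian manifold is a semi-Riemannian manifold with a non-null unit vector field $\xi$ belonging to $N(k)$. $M$ is $(R,S_{\mathcal{T}_a})$-semisymmetric if $R(X,Y)\cdot S_{\mathcal{T}_a}=0$ for all $X,Y$,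 i.e. $S_{\mathcal{T}_a}(R(X,Y)U,V)+S_{\mathcal{T}_a}(U,R(X,Y)V)=0$ for all $X,Y,U,V$.
   Formalization: The formal theorem additionally assumes k ≠ 0, since for k = 0 the claim fails: on ℝ × S² with ξ = ∂/∂t, ξ lies in N(0) and the manifold is semisymmetric for every choice of a_0,…,a_7, but S ≠ 0. *)

theory Defs
  imports "HOL-Analysis.Analysis"
begin

section \<open>Smooth functions on open subsets of Euclidean space\<close>

definition pdiff :: "'n \<Rightarrow> (real ^ 'n \<Rightarrow> real) \<Rightarrow> real ^ 'n \<Rightarrow> real" where
  "pdiff i f x = frechet_derivative f (at x) (axis i 1)"

text \<open>For open \<open>S\<close> this is the usual notion of being infinitely differentiable: every iterated
  partial derivative is differentiable, hence continuous, on \<open>S\<close>. It is only used for open \<open>S\<close>.\<close>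

definition smooth_on :: "(real ^ 'n) set \<Rightarrow> (real ^ 'n \<Rightarrow> real) \<Rightarrow> bool" where
  "smooth_on S f \<longleftrightarrow> (\<forall>is. \<forall>x\<in>S. fold pdiff is f differentiable (at x))"


section \<open>Smooth manifolds\<close>

text \<open>A chart is a pair of a coordinate neighbourhood \<open>U\<close> and a coordinate map, the latter being
  relevant only on \<open>U\<close>. The dimension is \<open>CARD('n)\<close>.\<close>

type_synonym ('m, 'n) chart = "'m set \<times> ('m \<Rightarrow> real ^ 'n)"

definition chart_image :: "('m, 'n::finite) chart \<Rightarrow> (real ^ 'n) set" where
  "chart_image c = snd c ` fst c"

definition chart_inv :: "('m, 'n::finite) chart \<Rightarrow> real ^ 'n \<Rightarrow> 'm" where
  "chart_inv c = inv_into (fst c) (snd c)"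

definition transition ::
    "('m, 'n::finite) chart \<Rightarrow> ('m, 'n) chart \<Rightarrow> real ^ 'n \<Rightarrow> real ^ 'n" where
  "transition c d = snd d \<circ> chart_inv c"

definition is_chart :: "'m topology \<Rightarrow> ('m, 'n::finite) chart \<Rightarrow> bool" where
  "is_chart M c \<longleftrightarrow>
     openin M (fst c) \<and> open (chart_image c) \<and>
     homeomorphic_map (subtopology M (fst c)) (top_of_set (chart_image c)) (snd c)"

definition smooth_manifold :: "'m topology \<Rightarrow> ('m, 'n::finite) chart set \<Rightarrow> bool" where
  "smooth_manifold M A \<longleftrightarrow>
     Hausdorff_space M \<and> second_countable M \<and>
     (\<forall>c\<in>A. is_chart M c) \<and> (\<Union>c\<in>A. fst c) = topspace M \<and>
     (\<forall>c\<in>A. \<forall>d\<in>A. \<forall>i. smooth_on (snd c ` (fst c \<inter> fst d)) (\<lambda>x. transition c d x $ i))"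

definition charts_at :: "('m, 'n::finite) chart set \<Rightarrow> 'm \<Rightarrow> ('m, 'n) chart set" where
  "charts_at A p = {c \<in> A. p \<in> fst c}"

text \<open>A tangent vector at \<open>p\<close> is the family of its component vectors with respect to all charts
  around \<open>p\<close>, related to each other by the derivatives of the transition maps. Sums and multiples
  of tangent vectors are taken componentwise; the zero vector is \<open>\<lambda>_. 0\<close>.\<close>

type_synonym ('m, 'n) tvec = "('m, 'n) chart \<Rightarrow> real ^ 'n"

definition tangent_space :: "('m, 'n::finite) chart set \<Rightarrow> 'm \<Rightarrow> ('m, 'n) tvec set" where
  "tangent_space A p =
     {X. (\<forall>c. c \<notin> charts_at A p \<longrightarrow> X c = 0) \<and>
         (\<forall>c\<in>charts_at A p. \<forall>d\<in>charts_at A p.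
            X d = frechet_derivative (transition c d) (at (snd c p)) (X c))}"

text \<open>The tangent vector at \<open>p\<close> whose component vector in the chart \<open>c\<close> around \<open>p\<close> is \<open>v\<close>; for
  \<open>v = axis i 1\<close> this is the \<open>i\<close>-th coordinate vector of \<open>c\<close>.\<close>

definition tangent_vec ::
    "('m, 'n::finite) chart set \<Rightarrow> 'm \<Rightarrow> ('m, 'n) chart \<Rightarrow> real ^ 'n \<Rightarrow> ('m, 'n) tvec" where
  "tangent_vec A p c v =
     (\<lambda>d. if d \<in> charts_at A p then frechet_derivative (transition c d) (at (snd c p)) v else 0)"

definition smooth_vector_field ::
    "'m topology \<Rightarrow> ('m, 'n::finite) chart set \<Rightarrow> ('m \<Rightarrow> ('m, 'n) tvec) \<Rightarrow> bool" where
  "smooth_vector_field M A \<xi> \<longleftrightarrow>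
     (\<forall>p\<in>topspace M. \<xi> p \<in> tangent_space A p) \<and>
     (\<forall>c\<in>A. \<forall>i. smooth_on (chart_image c) (\<lambda>x. \<xi> (chart_inv c x) c $ i))"


section \<open>Semi-Riemannian metrics\<close>

type_synonym ('m, 'n) metric = "'m \<Rightarrow> ('m, 'n) tvec \<Rightarrow> ('m, 'n) tvec \<Rightarrow> real"

definition gcoord ::
    "('m, 'n::finite) chart set \<Rightarrow> ('m, 'n) metric \<Rightarrow> ('m, 'n) chart \<Rightarrow>
     real ^ 'n \<Rightarrow> real ^ 'n ^ 'n" where
  "gcoord A g c x =
     (let p = chart_inv c x in
      \<chi> i j. g p (tangent_vec A p c (axis i 1)) (tangent_vec A p c (axis j 1)))"

text \<open>The index of a symmetric bilinear form, given by its matrix: the largest dimension of a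
  subspace on which it is negative definite.\<close>

definition form_index :: "real ^ 'n ^ 'n \<Rightarrow> nat" where
  "form_index G = Max {dim W | W. subspace W \<and> (\<forall>w\<in>W. w \<noteq> 0 \<longrightarrow> w \<bullet> (G *v w) < 0)}"

definition semi_riemannian_manifold ::
    "'m topology \<Rightarrow> ('m, 'n::finite) chart set \<Rightarrow> ('m, 'n) metric \<Rightarrow> bool" where
  "semi_riemannian_manifold M A g \<longleftrightarrow>
     smooth_manifold M A \<and>
     (\<forall>p\<in>topspace M.
        (\<forall>X\<in>tangent_space A p. \<forall>Y\<in>tangent_space A p. g p X Y = g p Y X) \<and>
        (\<forall>X\<in>tangent_space A p. \<forall>Y\<in>tangent_space A p. \<forall>Z\<in>tangent_space A p. \<forall>s t.
           g p (\<lambda>c. s *\<^sub>R X c + t *\<^sub>R Y c) Z = s * g p X Z + t * g p Y Z) \<and>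
        (\<forall>X\<in>tangent_space A p. (\<forall>Y\<in>tangent_space A p. g p X Y = 0) \<longrightarrow> X = (\<lambda>_. 0))) \<and>
     (\<forall>c\<in>A. \<forall>i j. smooth_on (chart_image c) (\<lambda>x. gcoord A g c x $ i $ j)) \<and>
     (\<exists>\<nu>. \<forall>c\<in>A. \<forall>x\<in>chart_image c. form_index (gcoord A g c x) = \<nu>)"


section \<open>Curvature of the Levi-Civita connection\<close>

text \<open>The connection satisfies \<open>\<nabla>\<^bsub>\<partial>i\<^esub> \<partial>j = (\<Sum>l. christoffel G x l i j \<partial>l)\<close>, and the sign convention for
  the curvature is \<open>R(X,Y)Z = \<nabla>\<^bsub>X\<^esub>\<nabla>\<^bsub>Y\<^esub>Z - \<nabla>\<^bsub>Y\<^esub>\<nabla>\<^bsub>X\<^esub>Z - \<nabla>\<^bsub>[X,Y]\<^esub>Z\<close>, so that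
  \<open>R(\<partial>i,\<partial>j)\<partial>k = (\<Sum>l. riem_coord G x l i j k \<partial>l)\<close>.\<close>

definition christoffel ::
    "(real ^ 'n \<Rightarrow> real ^ 'n ^ 'n) \<Rightarrow> real ^ 'n \<Rightarrow> 'n \<Rightarrow> 'n \<Rightarrow> 'n \<Rightarrow> real" where
  "christoffel G x l i j =
     (1 / 2) * (\<Sum>m\<in>UNIV. matrix_inv (G x) $ l $ m *
        (pdiff i (\<lambda>y. G y $ j $ m) x + pdiff j (\<lambda>y. G y $ i $ m) x - pdiff m (\<lambda>y. G y $ i $ j) x))"

definition riem_coord ::
    "(real ^ 'n \<Rightarrow> real ^ 'n ^ 'n) \<Rightarrow> real ^ 'n \<Rightarrow> 'n \<Rightarrow> 'n \<Rightarrow> 'n \<Rightarrow> 'n \<Rightarrow> real" where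
  "riem_coord G x l i j k =
     pdiff i (\<lambda>y. christoffel G y l j k) x - pdiff j (\<lambda>y. christoffel G y l i k) x
     + (\<Sum>m\<in>UNIV. christoffel G x l i m * christoffel G x m j k
               - christoffel G x l j m * christoffel G x m i k)"

text \<open>Tensors at \<open>p\<close> and traces of endomorphisms of the tangent space are evaluated in some chart
  around \<open>p\<close>; by tensoriality the result is the same for every chart.\<close>

definition chart_at :: "('m, 'n::finite) chart set \<Rightarrow> 'm \<Rightarrow> ('m, 'n) chart" where
  "chart_at A p = (SOME c. c \<in> charts_at A p)"

definition curvature ::
    "('m, 'n::finite) chart set \<Rightarrow> ('m, 'n) metric \<Rightarrow> 'm \<Rightarrow>
     ('m, 'n) tvec \<Rightarrow> ('m, 'n) tvec \<Rightarrow> ('m, 'n) tvec \<Rightarrow> ('m, 'n) tvec" where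
  "curvature A g p X Y Z =
     (let c = chart_at A p in
      tangent_vec A p c
        (\<chi> l. \<Sum>i\<in>UNIV. \<Sum>j\<in>UNIV. \<Sum>k\<in>UNIV.
           riem_coord (gcoord A g c) (snd c p) l i j k * X c $ i * Y c $ j * Z c $ k))"

definition tangent_trace ::
    "('m, 'n::finite) chart set \<Rightarrow> 'm \<Rightarrow> (('m, 'n) tvec \<Rightarrow> ('m, 'n) tvec) \<Rightarrow> real" where
  "tangent_trace A p F =
     (let c = chart_at A p in trace (matrix (\<lambda>v. F (tangent_vec A p c v) c)))"

definition ricci ::
    "('m, 'n::finite) chart set \<Rightarrow> ('m, 'n) metric \<Rightarrow> 'm \<Rightarrow>
     ('m, 'n) tvec \<Rightarrow> ('m, 'n) tvec \<Rightarrow> real" where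
  "ricci A g p Y Z = tangent_trace A p (\<lambda>X. curvature A g p X Y Z)"

definition ricci_op ::
    "('m, 'n::finite) chart set \<Rightarrow> ('m, 'n) metric \<Rightarrow> 'm \<Rightarrow> ('m, 'n) tvec \<Rightarrow> ('m, 'n) tvec" where
  "ricci_op A g p X =
     (THE Z. Z \<in> tangent_space A p \<and> (\<forall>Y\<in>tangent_space A p. g p Z Y = ricci A g p X Y))"

definition scalar_curvature ::
    "('m, 'n::finite) chart set \<Rightarrow> ('m, 'n) metric \<Rightarrow> 'm \<Rightarrow> real" where
  "scalar_curvature A g p = tangent_trace A p (ricci_op A g p)"


section \<open>Nullity distribution and semisymmetry\<close>

definition nullity ::
    "('m, 'n::finite) chart set \<Rightarrow> ('m, 'n) metric \<Rightarrow> real \<Rightarrow> 'm \<Rightarrow> ('m, 'n) tvec set" where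
  "nullity A g k p =
     {Z \<in> tangent_space A p. \<forall>X\<in>tangent_space A p. \<forall>Y\<in>tangent_space A p.
        curvature A g p X Y Z = (\<lambda>c. k *\<^sub>R (g p Y Z *\<^sub>R X c - g p X Z *\<^sub>R Y c))}"

definition Nk_xi_semi_riemannian_manifold ::
    "'m topology \<Rightarrow> ('m, 'n::finite) chart set \<Rightarrow> ('m, 'n) metric \<Rightarrow> real \<Rightarrow>
     ('m \<Rightarrow> ('m, 'n) tvec) \<Rightarrow> bool" where
  "Nk_xi_semi_riemannian_manifold M A g k \<xi> \<longleftrightarrow>
     semi_riemannian_manifold M A g \<and> smooth_vector_field M A \<xi> \<and>
     (\<forall>p\<in>topspace M. \<bar>g p (\<xi> p) (\<xi> p)\<bar> = 1 \<and> \<xi> p \<in> nullity A g k p)"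

text \<open>The Ricci-type contraction \<open>tr (X \<mapsto> T\<^sub>a(X,Y)Z)\<close> of the \<open>T\<^sub>a\<close>-curvature tensor with coefficients
  \<open>a 0, \<dots>, a 7\<close>.\<close>

definition S_T ::
    "('m, 'n::finite) chart set \<Rightarrow> ('m, 'n) metric \<Rightarrow> (nat \<Rightarrow> real) \<Rightarrow> 'm \<Rightarrow>
     ('m, 'n) tvec \<Rightarrow> ('m, 'n) tvec \<Rightarrow> real" where
  "S_T A g a p X Y =
     (a 0 + real CARD('n) * a 1 + a 2 + a 3 + a 5 + a 6) * ricci A g p X Y
     + (a 4 + (real CARD('n) - 1) * a 7) * scalar_curvature A g p * g p X Y"

definition R_S_T_semisymmetric ::
    "'m topology \<Rightarrow> ('m, 'n::finite) chart set \<Rightarrow> ('m, 'n) metric \<Rightarrow> (nat \<Rightarrow> real) \<Rightarrow> bool" where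
  "R_S_T_semisymmetric M A g a \<longleftrightarrow>
     (\<forall>p\<in>topspace M. \<forall>X\<in>tangent_space A p. \<forall>Y\<in>tangent_space A p.
        \<forall>U\<in>tangent_space A p. \<forall>V\<in>tangent_space A p.
        S_T A g a p (curvature A g p X Y U) V + S_T A g a p U (curvature A g p X Y V) = 0)"

end

theory Submission
  imports Defs
begin

text \<open>Write \<open>\<eta>(V) = g(V, \<xi>)\<close> and \<open>\<epsilon> = g(\<xi>, \<xi>) = \<plusminus>1\<close>. Since \<open>\<xi>\<close> lies in \<open>N(k)\<close>,
  \<open>R(X, \<xi>)\<xi> = k (\<epsilon> X - \<eta>(X) \<xi>)\<close>, and taking the trace of \<open>V \<mapsto> R(V, X)\<xi>\<close> gives
  \<open>S(X, \<xi>) = k (n - 1) \<eta>(X)\<close> (lemma \<open>ricci_nullity\<close>). Writing \<open>S\<^sub>T = \<alpha> S + \<beta> g\<close> at a point, one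
  gets \<open>S\<^sub>T(V, \<xi>) = C \<eta>(V)\<close> with \<open>C = \<alpha> k (n - 1) + \<beta>\<close>. Semisymmetry for the pair \<open>(X, \<xi>)\<close> acting on
  \<open>(U, \<xi>)\<close> reads \<open>S\<^sub>T(R(X, \<xi>)U, \<xi>) + S\<^sub>T(U, R(X, \<xi>)\<xi>) = 0\<close>. The first term is
  \<open>C g(R(X, \<xi>)U, \<xi>) = - C g(U, R(X, \<xi>)\<xi>)\<close> because curvature endomorphisms are skew-adjoint, so that
  \<open>S\<^sub>T - C g\<close> vanishes on \<open>(U, R(X, \<xi>)\<xi>)\<close>. It also vanishes on \<open>(U, \<xi>)\<close>, hence
  \<open>k \<epsilon> (S\<^sub>T - C g)(U, X) = 0\<close>, and dividing by \<open>k \<epsilon> \<alpha>\<close> gives \<open>S = k (n - 1) g\<close>. No symmetry of the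
  Ricci tensor enters.

  The work lies in the skew-adjointness (lemma \<open>curvature_skew\<close>), which has to be derived from the
  coordinate formulas for the Christoffel symbols. With \<open>\<Gamma>\<^sub>q\<^sub>i\<^sub>j\<close> the Christoffel symbols of the first
  kind (\<open>christoffel_lower\<close>), metric compatibility \<open>\<partial>\<^sub>i g\<^sub>q\<^sub>j = \<Gamma>\<^sub>q\<^sub>i\<^sub>j + \<Gamma>\<^sub>j\<^sub>i\<^sub>q\<close> turns the lowered
  curvature components \<open>R\<^sub>q\<^sub>i\<^sub>j\<^sub>k\<close> into \<open>\<partial>\<^sub>i \<Gamma>\<^sub>q\<^sub>j\<^sub>k - \<partial>\<^sub>j \<Gamma>\<^sub>q\<^sub>i\<^sub>k\<close> plus products of Christoffel symbols;
  adding the expression with \<open>q\<close> and \<open>k\<close> exchanged leaves \<open>\<partial>\<^sub>i\<partial>\<^sub>j g\<^sub>q\<^sub>k - \<partial>\<^sub>j\<partial>\<^sub>i g\<^sub>q\<^sub>k = 0\<close>.\<close>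

section \<open>Partial derivatives\<close>

lemma pdiff_along_axis:
  assumes "f differentiable (at (w + s *\<^sub>R axis i 1))"
  shows "((\<lambda>s. f (w + s *\<^sub>R axis i 1)) has_real_derivative pdiff i f (w + s *\<^sub>R axis i 1)) (at s)"
proof -
  let ?F = "frechet_derivative f (at (w + s *\<^sub>R axis i 1))"
  have F: "(f has_derivative ?F) (at (w + s *\<^sub>R axis i 1))"
    using assms frechet_derivative_works by blast
  have "((\<lambda>s. w + s *\<^sub>R axis i 1) has_derivative (\<lambda>h. h *\<^sub>R axis i (1::real))) (at s)"
    by (auto intro!: derivative_eq_intros)
  from has_derivative_compose[OF this F]
  have "((\<lambda>s. f (w + s *\<^sub>R axis i 1)) has_derivative (\<lambda>h. ?F (h *\<^sub>R axis i 1))) (at s)" .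
  moreover have "(\<lambda>h. ?F (h *\<^sub>R axis i 1)) = (\<lambda>h. h * pdiff i f (w + s *\<^sub>R axis i 1))"
    using linear_frechet_derivative[OF assms] by (auto simp: pdiff_def linear_cmul)
  ultimately show ?thesis
    by (simp add: has_field_derivative_def mult.commute[of _ "pdiff _ _ _"])
qed

lemma pdiff_MVT:
  assumes "0 < h" and "\<And>s. 0 \<le> s \<Longrightarrow> s \<le> h \<Longrightarrow> f differentiable (at (w + s *\<^sub>R axis i 1))"
  obtains s where "0 < s" "s < h" "f (w + h *\<^sub>R axis i 1) - f w = h * pdiff i f (w + s *\<^sub>R axis i 1)"
  using MVT2[OF assms(1), of "\<lambda>s. f (w + s *\<^sub>R axis i 1)" "\<lambda>s. pdiff i f (w + s *\<^sub>R axis i 1)"]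
    pdiff_along_axis[OF assms(2)] by auto

lemma pdiff_transform:
  assumes "f differentiable (at x)" "open S" "x \<in> S" "\<And>y. y \<in> S \<Longrightarrow> f y = g y"
  shows "pdiff i g x = pdiff i f x"
  unfolding pdiff_def using frechet_derivative_transform_within_open[OF assms] by simp

lemma pdiff_diff:
  assumes "f differentiable (at x)" "g differentiable (at x)"
  shows "pdiff i (\<lambda>y. f y - g y) x = pdiff i f x - pdiff i g x"
  using frechet_derivative_at[OF has_derivative_diff[OF assms[unfolded frechet_derivative_works]]]
  unfolding pdiff_def by metis

lemma pdiff_add:
  assumes "f differentiable (at x)" "g differentiable (at x)"
  shows "pdiff i (\<lambda>y. f y + g y) x = pdiff i f x + pdiff i g x"
  using frechet_derivative_at[OF has_derivative_add[OF assms[unfolded frechet_derivative_works]]]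
  unfolding pdiff_def by metis

lemma pdiff_mult:
  assumes "f differentiable (at x)" "g differentiable (at x)"
  shows "pdiff i (\<lambda>y. f y * g y) x = f x * pdiff i g x + pdiff i f x * g x"
  using frechet_derivative_at[OF has_derivative_mult[OF assms[unfolded frechet_derivative_works]]]
  unfolding pdiff_def by metis

lemma pdiff_sum:
  assumes "\<And>m. m \<in> I \<Longrightarrow> f m differentiable (at x)"
  shows "pdiff i (\<lambda>y. \<Sum>m\<in>I. f m y) x = (\<Sum>m\<in>I. pdiff i (f m) x)"
proof -
  have "((\<lambda>y. \<Sum>m\<in>I. f m y) has_derivative (\<lambda>h. \<Sum>m\<in>I. frechet_derivative (f m) (at x) h)) (at x)"
    using assms by (intro has_derivative_sum) (simp add: frechet_derivative_works)
  from frechet_derivative_at[OF this] show ?thesis unfolding pdiff_def by metis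
qed

text \<open>Two applications of the mean value theorem, along \<open>axis i 1\<close> and then along \<open>axis j 1\<close>. The
  difference on the left is symmetric in \<open>i\<close> and \<open>j\<close>, which is what makes the mixed partial
  derivatives agree in the limit \<open>h \<rightarrow> 0\<close>.\<close>

lemma second_difference:
  fixes x :: "real ^ 'n::finite"
  assumes h: "0 < h" and sub: "cball x (2 * h) \<subseteq> S"
    and f: "\<And>y. y \<in> S \<Longrightarrow> f differentiable (at y)"
    and fi: "\<And>y. y \<in> S \<Longrightarrow> pdiff i f differentiable (at y)"
  shows "\<exists>z\<in>cball x (2 * h). f (x + h *\<^sub>R axis i 1 + h *\<^sub>R axis j 1) - f (x + h *\<^sub>R axis i 1)
     - f (x + h *\<^sub>R axis j 1) + f x = h * h * pdiff j (pdiff i f) z"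
proof -
  let ?u = "axis i 1 :: real ^ 'n" and ?v = "axis j 1 :: real ^ 'n"
  have near: "x + s *\<^sub>R ?u + t *\<^sub>R ?v \<in> cball x (2 * h)" if "0 \<le> s" "s \<le> h" "0 \<le> t" "t \<le> h" for s t
  proof -
    have "norm (s *\<^sub>R ?u + t *\<^sub>R ?v) \<le> norm (s *\<^sub>R ?u) + norm (t *\<^sub>R ?v)" by (rule norm_triangle_ineq)
    also have "\<dots> \<le> 2 * h" using that by simp
    finally have "dist (x + (s *\<^sub>R ?u + t *\<^sub>R ?v)) x \<le> 2 * h" by (simp add: dist_norm)
    then show ?thesis by (simp add: dist_commute add.assoc)
  qed
  define D where "D y = f (y + h *\<^sub>R ?v) - f y" for y
  have arg: "x + s *\<^sub>R ?u + h *\<^sub>R ?v \<in> S" "x + s *\<^sub>R ?u \<in> S" if "0 \<le> s" "s \<le> h" for s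
    using near[of s h] near[of s 0] that h sub by auto
  have shift: "((\<lambda>y. f (y + h *\<^sub>R ?v)) has_derivative frechet_derivative f (at (y + h *\<^sub>R ?v))) (at y)"
    if "y + h *\<^sub>R ?v \<in> S" for y
  proof -
    have 1: "((\<lambda>y. y + h *\<^sub>R ?v) has_derivative (\<lambda>h. h)) (at y)"
      by (auto intro!: derivative_eq_intros)
    show ?thesis
      using has_derivative_compose[OF 1 f[OF that, unfolded frechet_derivative_works]] .
  qed
  have D1: "D differentiable (at y)" and D2: "pdiff i D y = pdiff i f (y + h *\<^sub>R ?v) - pdiff i f y"
    if "y + h *\<^sub>R ?v \<in> S" "y \<in> S" for y
  proof -
    have d: "(\<lambda>y. f (y + h *\<^sub>R ?v)) differentiable (at y)"
      using shift[OF that(1)] by (auto simp: differentiable_def)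
    then show "D differentiable (at y)"
      unfolding D_def using f[OF that(2)] by simp
    have "pdiff i (\<lambda>y. f (y + h *\<^sub>R ?v)) y = pdiff i f (y + h *\<^sub>R ?v)"
      unfolding pdiff_def using frechet_derivative_at[OF shift[OF that(1)]] by simp
    then show "pdiff i D y = pdiff i f (y + h *\<^sub>R ?v) - pdiff i f y"
      unfolding D_def using pdiff_diff[OF d f[OF that(2)]] by simp
  qed
  obtain s where s: "0 < s" "s < h" "D (x + h *\<^sub>R ?u) - D x = h * pdiff i D (x + s *\<^sub>R ?u)"
    using pdiff_MVT[OF h, of D x i] D1 arg by blast
  have "pdiff i f differentiable (at (x + s *\<^sub>R ?u + t *\<^sub>R ?v))" if "0 \<le> t" "t \<le> h" for t
    using fi near[of s t] s that sub by auto
  then obtain t where t: "0 < t" "t < h" "pdiff i f (x + s *\<^sub>R ?u + h *\<^sub>R ?v) - pdiff i f (x + s *\<^sub>R ?u)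
      = h * pdiff j (pdiff i f) (x + s *\<^sub>R ?u + t *\<^sub>R ?v)"
    using pdiff_MVT[OF h, of "pdiff i f" "x + s *\<^sub>R ?u" j] by blast
  have "D (x + h *\<^sub>R ?u) - D x = h * (h * pdiff j (pdiff i f) (x + s *\<^sub>R ?u + t *\<^sub>R ?v))"
    using s t D2 arg[of s] by simp
  then show ?thesis
    using near[of s t] s t unfolding D_def
    by (intro bexI[of _ "x + s *\<^sub>R ?u + t *\<^sub>R ?v"]) (simp_all add: algebra_simps)
qed

text \<open>Schwarz's theorem on the symmetry of second derivatives.\<close>

lemma pdiff_commute:
  fixes f :: "real ^ 'n::finite \<Rightarrow> real"
  assumes S: "open S" "x \<in> S" and f: "smooth_on S f"
  shows "pdiff i (pdiff j f) x = pdiff j (pdiff i f) x"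
proof (rule ccontr)
  assume ne: "pdiff i (pdiff j f) x \<noteq> pdiff j (pdiff i f) x"
  have d: "fold pdiff is f differentiable (at y)" if "y \<in> S" for "is" y
    using f that unfolding smooth_on_def by blast
  have d0: "f differentiable (at y)" and d1: "pdiff a f differentiable (at y)"
    and d2: "pdiff b (pdiff a f) differentiable (at y)" if "y \<in> S" for a b y
    using d[OF that, of "[]"] d[OF that, of "[a]"] d[OF that, of "[a,b]"] by auto
  \<comment> \<open>If the two values differed, both mixed derivatives would stay within half of the difference of
     their values at \<open>x\<close> on a small ball, yet both express the same second difference, so that a
     value of one on that ball equals a value of the other.\<close>
  define e where "e = \<bar>pdiff i (pdiff j f) x - pdiff j (pdiff i f) x\<bar> / 2"
  have e: "e > 0" using ne by (simp add: e_def)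
  have cont: "\<exists>r>0. \<forall>y. dist y x < r \<longrightarrow> \<bar>pdiff b (pdiff a f) y - pdiff b (pdiff a f) x\<bar> < e" for a b
    using differentiable_imp_continuous_within[OF d2[OF S(2)], of b a] e
    unfolding continuous_at_eps_delta by (auto simp: dist_real_def)
  obtain r1 where r1: "r1 > 0" "\<And>y. dist y x < r1 \<Longrightarrow> \<bar>pdiff i (pdiff j f) y - pdiff i (pdiff j f) x\<bar> < e"
    using cont by blast
  obtain r2 where r2: "r2 > 0" "\<And>y. dist y x < r2 \<Longrightarrow> \<bar>pdiff j (pdiff i f) y - pdiff j (pdiff i f) x\<bar> < e"
    using cont by blast
  obtain r3 where r3: "r3 > 0" "cball x r3 \<subseteq> S"
    using S open_contains_cball by blast
  define h where "h = min r3 (min r1 r2) / 4"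
  have h: "0 < h" "2 * h < r1" "2 * h < r2" "2 * h \<le> r3"
    using r1(1) r2(1) r3(1) by (auto simp: h_def)
  have sub: "cball x (2 * h) \<subseteq> S" using h r3 by auto
  obtain z where z: "z \<in> cball x (2 * h)" "f (x + h *\<^sub>R axis i 1 + h *\<^sub>R axis j 1) - f (x + h *\<^sub>R axis i 1)
     - f (x + h *\<^sub>R axis j 1) + f x = h * h * pdiff j (pdiff i f) z"
    using second_difference[OF h(1) sub d0 d1] by blast
  obtain z' where z': "z' \<in> cball x (2 * h)" "f (x + h *\<^sub>R axis j 1 + h *\<^sub>R axis i 1) - f (x + h *\<^sub>R axis j 1)
     - f (x + h *\<^sub>R axis i 1) + f x = h * h * pdiff i (pdiff j f) z'"
    using second_difference[OF h(1) sub d0 d1] by blast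
  have "x + h *\<^sub>R axis j 1 + h *\<^sub>R axis i 1 = x + h *\<^sub>R axis i 1 + h *\<^sub>R axis j 1"
    by (simp add: algebra_simps)
  then have "h * h * pdiff j (pdiff i f) z = h * h * pdiff i (pdiff j f) z'"
    using z(2) z'(2) by (smt (verit))
  then have "pdiff j (pdiff i f) z = pdiff i (pdiff j f) z'" using h(1) by simp
  moreover have "\<bar>pdiff j (pdiff i f) z - pdiff j (pdiff i f) x\<bar> < e"
    using z(1) h by (intro r2(2)) (simp add: dist_commute)
  moreover have "\<bar>pdiff i (pdiff j f) z' - pdiff i (pdiff j f) x\<bar> < e"
    using z'(1) h by (intro r1(2)) (simp add: dist_commute)
  ultimately show False unfolding e_def by (simp add: abs_if split: if_splits)
qed

section \<open>Differentiability of the inverse matrix\<close>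

lemma differentiable_prod:
  fixes f :: "'i \<Rightarrow> 'a::real_normed_vector \<Rightarrow> real"
  assumes "\<And>i. i \<in> I \<Longrightarrow> f i differentiable (at x)"
  shows "(\<lambda>y. \<Prod>i\<in>I. f i y) differentiable (at x)"
  using assms by (induction I rule: infinite_finite_induct) auto

lemma differentiable_det:
  fixes B :: "'a::real_normed_vector \<Rightarrow> real ^ 'n ^ 'n::finite"
  assumes "\<And>i j. (\<lambda>y. B y $ i $ j) differentiable (at x)"
  shows "(\<lambda>y. det (B y)) differentiable (at x)"
  unfolding det_def using assms
  by (intro differentiable_sum finite_permutations ballI differentiable_mult differentiable_prod) auto

lemma matrix_mul_matrix_inv:
  fixes B :: "real ^ 'n ^ 'n::finite"
  assumes "invertible B"
  shows "B ** matrix_inv B = mat 1"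
  using someI_ex[OF assms[unfolded invertible_def]] unfolding matrix_inv_def by blast

text \<open>Cramer's rule.\<close>

lemma matrix_inv_entry:
  fixes B :: "real ^ 'n ^ 'n::finite"
  assumes "det B \<noteq> 0"
  shows "matrix_inv B $ l $ m = det (\<chi> i j. if j = l then axis m 1 $ i else B $ i $ j) / det B"
proof -
  have inv: "invertible B" using assms invertible_det_nz by blast
  have "B *v (matrix_inv B *v axis m 1) = axis m 1"
    using matrix_mul_matrix_inv[OF inv] by (simp add: matrix_vector_mul_assoc)
  then have "matrix_inv B *v axis m 1 = (\<chi> k. det (\<chi> i j. if j = k then axis m 1 $ i else B $ i $ j) / det B)"
    using cramer[OF assms] by blast
  then have "(matrix_inv B *v axis m 1) $ l = det (\<chi> i j. if j = l then axis m 1 $ i else B $ i $ j) / det B"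
    by simp
  then show ?thesis by (simp add: matrix_vector_mult_basis column_def)
qed

lemma differentiable_matrix_inv:
  fixes B :: "'a::real_normed_vector \<Rightarrow> real ^ 'n ^ 'n::finite"
  assumes B: "\<And>i j. (\<lambda>y. B y $ i $ j) differentiable (at x)"
    and S: "open S" "x \<in> S" and inv: "\<And>y. y \<in> S \<Longrightarrow> invertible (B y)"
  shows "(\<lambda>y. matrix_inv (B y) $ l $ m) differentiable (at x)"
proof -
  let ?C = "\<lambda>y. det (\<chi> i j. if j = l then axis m 1 $ i else B y $ i $ j) / det (B y)"
  have C: "?C differentiable (at x)"
  proof (intro differentiable_divide differentiable_det)
    show "(\<lambda>y. (\<chi> i j. if j = l then axis m 1 $ i else B y $ i $ j) $ i $ j) differentiable (at x)" for i j
      using B by (cases "j = l") simp_all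
  qed (use B inv[OF S(2)] invertible_det_nz in auto)
  have eq: "?C y = matrix_inv (B y) $ l $ m" if "y \<in> S" for y
    using matrix_inv_entry[of "B y" l m] inv[OF that] invertible_det_nz[of "B y"] by simp
  obtain C' where "(?C has_derivative C') (at x)"
    using C unfolding differentiable_def by blast
  then have "((\<lambda>y. matrix_inv (B y) $ l $ m) has_derivative C') (at x)"
    by (rule has_derivative_transform_within_open[OF _ S eq])
  then show ?thesis unfolding differentiable_def by blast
qed

section \<open>Linear maps and iterated sums\<close>

lemma linear_vec_expansion:
  fixes f :: "real ^ 'n::finite \<Rightarrow> 'b::real_vector"
  assumes "linear f"
  shows "f v = (\<Sum>i\<in>UNIV. (v $ i) *\<^sub>R f (axis i 1))"
proof -
  have "f v = f (\<Sum>i\<in>UNIV. (v $ i) *\<^sub>R axis i 1)"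
    using basis_expansion[of v] by (simp add: scalar_mult_eq_scaleR)
  then show ?thesis by (simp add: linear_sum[OF assms] linear_cmul[OF assms])
qed

lemma sum_rotate3:
  "(\<Sum>a\<in>A. \<Sum>i\<in>I. \<Sum>j\<in>J. \<Sum>k\<in>K. f a i j k) = (\<Sum>i\<in>I. \<Sum>j\<in>J. \<Sum>k\<in>K. \<Sum>a\<in>A. f a i j k)"
proof -
  have "(\<Sum>a\<in>A. \<Sum>i\<in>I. \<Sum>j\<in>J. \<Sum>k\<in>K. f a i j k) = (\<Sum>i\<in>I. \<Sum>a\<in>A. \<Sum>j\<in>J. \<Sum>k\<in>K. f a i j k)"
    by (rule sum.swap)
  also have "\<dots> = (\<Sum>i\<in>I. \<Sum>j\<in>J. \<Sum>a\<in>A. \<Sum>k\<in>K. f a i j k)"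
    by (intro sum.cong refl sum.swap)
  also have "\<dots> = (\<Sum>i\<in>I. \<Sum>j\<in>J. \<Sum>k\<in>K. \<Sum>a\<in>A. f a i j k)"
    by (intro sum.cong refl sum.swap)
  finally show ?thesis .
qed


section \<open>Curvature in coordinates\<close>

text \<open>Christoffel symbols of the first kind: the Christoffel symbols \<open>christoffel G x l i j\<close> with the
  upper index lowered by \<open>G x\<close>. The index in the first place is the lowered one.\<close>

definition christoffel_lower ::
    "(real ^ 'n \<Rightarrow> real ^ 'n ^ 'n) \<Rightarrow> real ^ 'n \<Rightarrow> 'n \<Rightarrow> 'n \<Rightarrow> 'n \<Rightarrow> real" where
  "christoffel_lower G x q i j =
     (pdiff i (\<lambda>y. G y $ j $ q) x + pdiff j (\<lambda>y. G y $ i $ q) x - pdiff q (\<lambda>y. G y $ i $ j) x) / 2"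

text \<open>The components of a semi-Riemannian metric on an open subset of Euclidean space. The conditions
  are required only on \<open>S\<close>, the domain of the coordinates.\<close>

locale local_metric =
  fixes S :: "(real ^ 'n::finite) set" and G :: "real ^ 'n \<Rightarrow> real ^ 'n ^ 'n"
  assumes open_S: "open S"
    and smooth: "smooth_on S (\<lambda>x. G x $ i $ j)"
    and sym: "x \<in> S \<Longrightarrow> G x $ i $ j = G x $ j $ i"
    and inv: "x \<in> S \<Longrightarrow> invertible (G x)"
begin

lemma G_differentiable:
  assumes "x \<in> S"
  shows "(\<lambda>y. G y $ i $ j) differentiable (at x)"
    and "pdiff a (\<lambda>y. G y $ i $ j) differentiable (at x)"
proof -
  have d: "fold pdiff is (\<lambda>y. G y $ i $ j) differentiable (at x)" for "is"
    using smooth assms unfolding smooth_on_def by blast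
  show "(\<lambda>y. G y $ i $ j) differentiable (at x)" "pdiff a (\<lambda>y. G y $ i $ j) differentiable (at x)"
    using d[of "[]"] d[of "[a]"] by auto
qed

lemma pdiff_G_sym:
  assumes "x \<in> S"
  shows "pdiff a (\<lambda>y. G y $ i $ j) x = pdiff a (\<lambda>y. G y $ j $ i) x"
  by (rule pdiff_transform[OF G_differentiable(1)[OF assms] open_S assms sym])

lemma christoffel_lower_differentiable:
  assumes "x \<in> S"
  shows "(\<lambda>y. christoffel_lower G y q i j) differentiable (at x)"
  unfolding christoffel_lower_def
  by (intro differentiable_divide differentiable_add differentiable_diff
      G_differentiable[OF assms] differentiable_const) simp

lemma christoffel_differentiable:
  assumes "x \<in> S"
  shows "(\<lambda>y. christoffel G y l i j) differentiable (at x)"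
  unfolding christoffel_def
  by (intro differentiable_mult differentiable_sum ballI differentiable_add differentiable_diff
      G_differentiable[OF assms] differentiable_const
      differentiable_matrix_inv[OF G_differentiable(1)[OF assms] open_S assms inv]) auto

lemma lower_christoffel:
  assumes "x \<in> S"
  shows "(\<Sum>l\<in>UNIV. G x $ q $ l * christoffel G x l i j) = christoffel_lower G x q i j"
proof -
  let ?c = "\<lambda>m. christoffel_lower G x m i j"
  have delta: "(\<Sum>l\<in>UNIV. G x $ q $ l * matrix_inv (G x) $ l $ m) = (if q = m then 1 else 0)" for m
    using matrix_mul_matrix_inv[OF inv[OF assms]]
    by (simp add: vec_eq_iff matrix_matrix_mult_def mat_def)
  have "(\<Sum>l\<in>UNIV. G x $ q $ l * christoffel G x l i j)
      = (\<Sum>l\<in>UNIV. \<Sum>m\<in>UNIV. (G x $ q $ l * matrix_inv (G x) $ l $ m) * ?c m)"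
    by (simp add: christoffel_def christoffel_lower_def sum_distrib_left mult.assoc field_simps)
  also have "\<dots> = (\<Sum>m\<in>UNIV. (\<Sum>l\<in>UNIV. G x $ q $ l * matrix_inv (G x) $ l $ m) * ?c m)"
    by (subst sum.swap) (simp add: sum_distrib_right)
  also have "\<dots> = (\<Sum>m\<in>UNIV. if q = m then ?c m else 0)"
    unfolding delta by (intro sum.cong refl) simp
  also have "\<dots> = ?c q" by simp
  finally show ?thesis .
qed

lemma metric_compatibility:
  assumes "x \<in> S"
  shows "pdiff i (\<lambda>y. G y $ q $ j) x = christoffel_lower G x q i j + christoffel_lower G x j i q"
  using pdiff_G_sym[OF assms, of i q j] pdiff_G_sym[OF assms, of q i j] pdiff_G_sym[OF assms, of j i q]
  by (simp add: christoffel_lower_def field_simps)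

lemma christoffel_product_sym:
  assumes "x \<in> S"
  shows "(\<Sum>l\<in>UNIV. christoffel_lower G x l a b * christoffel G x l c d)
       = (\<Sum>l\<in>UNIV. christoffel_lower G x l c d * christoffel G x l a b)"
proof -
  have "(\<Sum>l\<in>UNIV. christoffel_lower G x l a b * christoffel G x l c d)
      = (\<Sum>l\<in>UNIV. \<Sum>m\<in>UNIV. G x $ l $ m * christoffel G x m a b * christoffel G x l c d)"
    by (simp flip: lower_christoffel[OF assms] add: sum_distrib_right)
  also have "\<dots> = (\<Sum>m\<in>UNIV. \<Sum>l\<in>UNIV. G x $ m $ l * christoffel G x l c d * christoffel G x m a b)"
    by (subst sum.swap) (intro sum.cong refl, simp add: sym[OF assms] mult_ac)
  also have "\<dots> = (\<Sum>l\<in>UNIV. christoffel_lower G x l c d * christoffel G x l a b)"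
    by (simp flip: lower_christoffel[OF assms] add: sum_distrib_right)
  finally show ?thesis .
qed

text \<open>Differentiating \<open>\<Gamma>\<^sub>q\<^sub>j\<^sub>k = (\<Sum>l. g\<^sub>q\<^sub>l \<Gamma>\<^sup>l\<^sub>j\<^sub>k)\<close> by the product rule and eliminating the derivatives of
  the metric by metric compatibility.\<close>

lemma lower_pdiff_christoffel:
  assumes "x \<in> S"
  shows "(\<Sum>l\<in>UNIV. G x $ q $ l * pdiff i (\<lambda>y. christoffel G y l j k) x)
       = pdiff i (\<lambda>y. christoffel_lower G y q j k) x
         - (\<Sum>l\<in>UNIV. (christoffel_lower G x q i l + christoffel_lower G x l i q) * christoffel G x l j k)"
proof -
  have "pdiff i (\<lambda>y. christoffel_lower G y q j k) x
      = pdiff i (\<lambda>y. \<Sum>l\<in>UNIV. G y $ q $ l * christoffel G y l j k) x"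
    by (rule pdiff_transform[OF _ open_S assms lower_christoffel])
      (intro differentiable_sum ballI differentiable_mult G_differentiable[OF assms]
        christoffel_differentiable[OF assms] finite)
  also have "\<dots> = (\<Sum>l\<in>UNIV. pdiff i (\<lambda>y. G y $ q $ l * christoffel G y l j k) x)"
    by (intro pdiff_sum differentiable_mult G_differentiable[OF assms] christoffel_differentiable[OF assms])
  also have "\<dots> = (\<Sum>l\<in>UNIV. G x $ q $ l * pdiff i (\<lambda>y. christoffel G y l j k) x
      + (christoffel_lower G x q i l + christoffel_lower G x l i q) * christoffel G x l j k)"
    by (simp add: pdiff_mult[OF G_differentiable(1)[OF assms] christoffel_differentiable[OF assms]]
        metric_compatibility[OF assms])
  finally show ?thesis by (simp add: sum.distrib)
qed

text \<open>The summands containing \<open>\<Gamma>\<^sub>q\<^sub>i\<^sub>l \<Gamma>\<^sup>l\<^sub>j\<^sub>k\<close> cancel between the derivative part and the quadratic part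
  of the curvature, and so do those with \<open>i\<close> and \<open>j\<close> exchanged.\<close>

lemma lower_riem:
  assumes "x \<in> S"
  shows "(\<Sum>l\<in>UNIV. G x $ q $ l * riem_coord G x l i j k)
       = pdiff i (\<lambda>y. christoffel_lower G y q j k) x - pdiff j (\<lambda>y. christoffel_lower G y q i k) x
         - (\<Sum>l\<in>UNIV. christoffel_lower G x l i q * christoffel G x l j k)
         + (\<Sum>l\<in>UNIV. christoffel_lower G x l j q * christoffel G x l i k)"
proof -
  have quad: "(\<Sum>l\<in>UNIV. G x $ q $ l * (\<Sum>m\<in>UNIV. christoffel G x l a m * christoffel G x m b k))
      = (\<Sum>m\<in>UNIV. christoffel_lower G x q a m * christoffel G x m b k)" for a b
    unfolding lower_christoffel[OF assms, symmetric] sum_distrib_left sum_distrib_right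
    by (subst sum.swap) (simp add: mult_ac)
  have "(\<Sum>l\<in>UNIV. G x $ q $ l * riem_coord G x l i j k)
      = (\<Sum>l\<in>UNIV. G x $ q $ l * pdiff i (\<lambda>y. christoffel G y l j k) x)
      - (\<Sum>l\<in>UNIV. G x $ q $ l * pdiff j (\<lambda>y. christoffel G y l i k) x)
      + ((\<Sum>l\<in>UNIV. G x $ q $ l * (\<Sum>m\<in>UNIV. christoffel G x l i m * christoffel G x m j k))
      - (\<Sum>l\<in>UNIV. G x $ q $ l * (\<Sum>m\<in>UNIV. christoffel G x l j m * christoffel G x m i k)))"
    unfolding riem_coord_def by (simp add: sum_subtractf sum.distrib algebra_simps)
  then show ?thesis
    unfolding quad lower_pdiff_christoffel[OF assms]
    by (simp add: sum.distrib algebra_simps)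
qed

text \<open>\<open>R\<^sub>q\<^sub>i\<^sub>j\<^sub>k = - R\<^sub>k\<^sub>i\<^sub>j\<^sub>q\<close>: the derivative terms cancel by Schwarz's theorem, the quadratic terms by
  \<open>christoffel_product_sym\<close>.\<close>

lemma riem_skew:
  assumes "x \<in> S"
  shows "(\<Sum>l\<in>UNIV. G x $ q $ l * riem_coord G x l i j k)
       = - (\<Sum>l\<in>UNIV. G x $ k $ l * riem_coord G x l i j q)"
proof -
  have deriv: "pdiff a (\<lambda>y. christoffel_lower G y q b k) x + pdiff a (\<lambda>y. christoffel_lower G y k b q) x
      = pdiff a (pdiff b (\<lambda>y. G y $ q $ k)) x" for a b
  proof -
    have "pdiff a (\<lambda>y. christoffel_lower G y q b k + christoffel_lower G y k b q) x
        = pdiff a (pdiff b (\<lambda>y. G y $ q $ k)) x"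
      by (rule pdiff_transform[OF G_differentiable(2)[OF assms] open_S assms metric_compatibility])
    then show ?thesis
      using pdiff_add[OF christoffel_lower_differentiable[OF assms]
          christoffel_lower_differentiable[OF assms]] by metis
  qed
  have "pdiff i (pdiff j (\<lambda>y. G y $ q $ k)) x = pdiff j (pdiff i (\<lambda>y. G y $ q $ k)) x"
    by (rule pdiff_commute[OF open_S assms smooth])
  then show ?thesis
    unfolding lower_riem[OF assms]
    using deriv[of i j] deriv[of j i] christoffel_product_sym[OF assms, of i q j k]
      christoffel_product_sym[OF assms, of j q i k] by linarith
qed

end

section \<open>Charts and tangent vectors\<close>

lemma chart_inj:
  assumes "is_chart M c" shows "inj_on (snd c) (fst c)"
  using assms homeomorphic_imp_injective_map[of "subtopology M (fst c)" _ "snd c"]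
    openin_subset[of M "fst c"]
  unfolding is_chart_def by (auto simp: topspace_subtopology Int_absorb1)

lemma chart_inv_left:
  assumes "is_chart M c" "q \<in> fst c" shows "chart_inv c (snd c q) = q"
  unfolding chart_inv_def using chart_inj[OF assms(1)] assms(2) by simp

lemma open_chart_subset:
  assumes "is_chart M c" "openin M U" shows "open (snd c ` (fst c \<inter> U))"
proof -
  have c: "openin M (fst c)" "open (chart_image c)"
    "homeomorphic_map (subtopology M (fst c)) (top_of_set (chart_image c)) (snd c)"
    using assms(1) unfolding is_chart_def by auto
  have "openin (subtopology M (fst c)) (fst c \<inter> U)"
    using assms(2) by (auto simp: openin_subtopology)
  then have "openin (top_of_set (chart_image c)) (snd c ` (fst c \<inter> U))"
    using homeomorphic_imp_open_map[OF c(3)] unfolding open_map_def by blast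
  then show ?thesis using c(2) openin_open_trans by blast
qed

locale manifold =
  fixes M :: "'m topology" and A :: "('m, 'n::finite) chart set"
  assumes mfd: "smooth_manifold M A"
begin

lemma atlas_chart: "c \<in> A \<Longrightarrow> is_chart M c"
  using mfd unfolding smooth_manifold_def by auto

lemma chart_at_in:
  assumes "p \<in> topspace M" shows "chart_at A p \<in> charts_at A p"
proof -
  have "\<exists>c. c \<in> charts_at A p"
    using mfd assms unfolding smooth_manifold_def charts_at_def by blast
  then show ?thesis unfolding chart_at_def by (rule someI_ex)
qed

lemma transition_apply:
  assumes "c \<in> A" "q \<in> fst c" shows "transition c d (snd c q) = snd d q"
  using chart_inv_left[OF atlas_chart] assms unfolding transition_def by simp

lemma transition_differentiable:
  assumes "c \<in> charts_at A p" "d \<in> charts_at A p"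
  shows "transition c d differentiable (at (snd c p))"
proof -
  have sm: "smooth_on (snd c ` (fst c \<inter> fst d)) (\<lambda>x. transition c d x $ i)" for i
    using mfd assms unfolding smooth_manifold_def charts_at_def by auto
  have mem: "snd c p \<in> snd c ` (fst c \<inter> fst d)"
    using assms unfolding charts_at_def by auto
  have comp: "(\<lambda>x. transition c d x $ i) differentiable (at (snd c p))" for i
    using sm[of i, unfolded smooth_on_def, THEN spec, of "[]", THEN bspec, OF mem] by simp
  show ?thesis
  proof (rule differentiable_componentwise_within[THEN iffD2], rule ballI)
    fix b :: "real ^ 'n" assume "b \<in> Basis"
    then obtain i where "b = axis i 1" by (auto simp: Basis_vec_def)
    then show "(\<lambda>x. transition c d x \<bullet> b) differentiable (at (snd c p))"
      using comp[of i] by (simp add: inner_axis)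
  qed
qed

lemma transition_derivative:
  assumes "c \<in> charts_at A p" "d \<in> charts_at A p"
  shows "(transition c d has_derivative frechet_derivative (transition c d) (at (snd c p))) (at (snd c p))"
  using transition_differentiable[OF assms] frechet_derivative_works by blast

text \<open>The chain rule for the cocycle identity of the transition maps, which holds near the image of
  \<open>p\<close> only. It is what makes \<open>tangent_vec A p c v\<close> a tangent vector.\<close>

lemma transition_chain:
  assumes "c \<in> charts_at A p" "d \<in> charts_at A p" "e \<in> charts_at A p"
  shows "frechet_derivative (transition d e) (at (snd d p)) (frechet_derivative (transition c d) (at (snd c p)) v)
    = frechet_derivative (transition c e) (at (snd c p)) v"
proof -
  have A: "c \<in> A" "d \<in> A" "p \<in> fst c" "p \<in> fst d"
    using assms unfolding charts_at_def by auto
  have op: "open (snd c ` (fst c \<inter> fst d))"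
    using open_chart_subset[OF atlas_chart[OF A(1)]] atlas_chart[OF A(2)] unfolding is_chart_def by blast
  have "(transition d e has_derivative frechet_derivative (transition d e) (at (snd d p)))
      (at (transition c d (snd c p)))"
    using transition_derivative[OF assms(2,3)] transition_apply[OF A(1,3)] by simp
  note comp = has_derivative_compose[OF transition_derivative[OF assms(1,2)] this]
  have eq: "transition d e (transition c d y) = transition c e y" if "y \<in> snd c ` (fst c \<inter> fst d)" for y
  proof -
    obtain q where "q \<in> fst c" "q \<in> fst d" "y = snd c q"
      using \<open>y \<in> snd c ` (fst c \<inter> fst d)\<close> by blast
    then show ?thesis using transition_apply[OF A(1)] transition_apply[OF A(2)] by simp
  qed
  have "snd c p \<in> snd c ` (fst c \<inter> fst d)" using A(3,4) by blast
  from has_derivative_transform_within_open[OF comp op this eq]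
  have "(transition c e has_derivative
      (\<lambda>v. frechet_derivative (transition d e) (at (snd d p)) (frechet_derivative (transition c d) (at (snd c p)) v)))
      (at (snd c p))" .
  from fun_cong[OF frechet_derivative_at[OF this], of v] show ?thesis .
qed

lemma tangent_vec_self:
  assumes "c \<in> charts_at A p" shows "tangent_vec A p c v c = v"
proof -
  have A: "c \<in> A" "p \<in> fst c" using assms unfolding charts_at_def by auto
  have op: "open (chart_image c)" using atlas_chart[OF A(1)] unfolding is_chart_def by blast
  have eq: "y = transition c c y" if "y \<in> chart_image c" for y
  proof -
    obtain q where "q \<in> fst c" "y = snd c q" using \<open>y \<in> chart_image c\<close> unfolding chart_image_def by blast
    then show ?thesis using transition_apply[OF A(1)] by simp
  qed
  have "snd c p \<in> chart_image c" using A(2) unfolding chart_image_def by blast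
  from has_derivative_transform_within_open[OF has_derivative_ident op this eq]
  have "(transition c c has_derivative (\<lambda>v. v)) (at (snd c p))" .
  from fun_cong[OF frechet_derivative_at[OF this], of v] show ?thesis
    using assms unfolding tangent_vec_def by simp
qed

lemma tangent_vec_in:
  assumes "c \<in> charts_at A p" shows "tangent_vec A p c v \<in> tangent_space A p"
  unfolding tangent_space_def mem_Collect_eq
proof (intro conjI ballI allI impI)
  show "tangent_vec A p c v d = 0" if "d \<notin> charts_at A p" for d
    using that by (simp add: tangent_vec_def)
  show "tangent_vec A p c v e = frechet_derivative (transition d e) (at (snd d p)) (tangent_vec A p c v d)"
    if "d \<in> charts_at A p" "e \<in> charts_at A p" for d e
    using that transition_chain[OF assms that] by (simp add: tangent_vec_def)
qed

lemma tangent_vec_component: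
  assumes "c \<in> charts_at A p" "X \<in> tangent_space A p" shows "tangent_vec A p c (X c) = X"
proof
  fix d
  have "d \<notin> charts_at A p \<Longrightarrow> X d = 0"
    and "d \<in> charts_at A p \<Longrightarrow> X d = frechet_derivative (transition c d) (at (snd c p)) (X c)"
    using assms unfolding tangent_space_def by blast+
  then show "tangent_vec A p c (X c) d = X d"
    by (simp add: tangent_vec_def)
qed

lemma tangent_vec_linear:
  assumes "c \<in> charts_at A p"
  shows "tangent_vec A p c (s *\<^sub>R v + t *\<^sub>R w) = (\<lambda>d. s *\<^sub>R tangent_vec A p c v d + t *\<^sub>R tangent_vec A p c w d)"
proof
  fix d
  show "tangent_vec A p c (s *\<^sub>R v + t *\<^sub>R w) d = s *\<^sub>R tangent_vec A p c v d + t *\<^sub>R tangent_vec A p c w d"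
    using linear_frechet_derivative[OF transition_differentiable[OF assms, of d]]
    by (auto simp: tangent_vec_def linear_add linear_cmul)
qed

lemma curvature_in: "p \<in> topspace M \<Longrightarrow> curvature A g p X Y Z \<in> tangent_space A p"
  unfolding curvature_def Let_def by (rule tangent_vec_in[OF chart_at_in])

lemma ricci_coord:
  assumes "p \<in> topspace M"
  defines "c \<equiv> chart_at A p"
  shows "ricci A g p Y Z = (\<Sum>l\<in>UNIV. \<Sum>i\<in>UNIV. \<Sum>j\<in>UNIV. \<Sum>k\<in>UNIV.
    riem_coord (gcoord A g c) (snd c p) l i j k * axis l 1 $ i * Y c $ j * Z c $ k)"
  unfolding ricci_def tangent_trace_def curvature_def Let_def trace_def matrix_def c_def
  by (simp add: tangent_vec_self[OF chart_at_in[OF assms(1)]])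

lemma ricci_linear_right:
  assumes "p \<in> topspace M"
  shows "ricci A g p Y (\<lambda>d. s *\<^sub>R Z d + t *\<^sub>R W d) = s * ricci A g p Y Z + t * ricci A g p Y W"
  unfolding ricci_coord[OF assms] sum_distrib_left sum.distrib[symmetric]
  by (intro sum.cong refl) (simp add: algebra_simps)

end

section \<open>Semi-Riemannian metrics and curvature on the manifold\<close>

locale semi_riemannian = manifold M A for M :: "'m topology" and A :: "('m, 'n::finite) chart set" +
  fixes g :: "('m, 'n) metric"
  assumes semi_riem: "semi_riemannian_manifold M A g"
begin

lemma
  assumes p: "p \<in> topspace M"
  shows metric_sym: "X \<in> tangent_space A p \<Longrightarrow> Y \<in> tangent_space A p \<Longrightarrow> g p X Y = g p Y X"
    and metric_linear_left: "X \<in> tangent_space A p \<Longrightarrow> Y \<in> tangent_space A p \<Longrightarrow> Z \<in> tangent_space A p \<Longrightarrow>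
      g p (\<lambda>c. s *\<^sub>R X c + t *\<^sub>R Y c) Z = s * g p X Z + t * g p Y Z"
    and metric_nondegenerate: "X \<in> tangent_space A p \<Longrightarrow>
      (\<And>Y. Y \<in> tangent_space A p \<Longrightarrow> g p X Y = 0) \<Longrightarrow> X = (\<lambda>_. 0)"
proof -
  have *: "(\<forall>X\<in>tangent_space A p. \<forall>Y\<in>tangent_space A p. g p X Y = g p Y X) \<and>
    (\<forall>X\<in>tangent_space A p. \<forall>Y\<in>tangent_space A p. \<forall>Z\<in>tangent_space A p. \<forall>s t.
       g p (\<lambda>c. s *\<^sub>R X c + t *\<^sub>R Y c) Z = s * g p X Z + t * g p Y Z) \<and>
    (\<forall>X\<in>tangent_space A p. (\<forall>Y\<in>tangent_space A p. g p X Y = 0) \<longrightarrow> X = (\<lambda>_. 0))"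
    using semi_riem[unfolded semi_riemannian_manifold_def, THEN conjunct2, THEN conjunct1, THEN bspec, OF p] .
  show "X \<in> tangent_space A p \<Longrightarrow> Y \<in> tangent_space A p \<Longrightarrow> g p X Y = g p Y X"
    using *[THEN conjunct1] by blast
  show "X \<in> tangent_space A p \<Longrightarrow> Y \<in> tangent_space A p \<Longrightarrow> Z \<in> tangent_space A p \<Longrightarrow>
      g p (\<lambda>c. s *\<^sub>R X c + t *\<^sub>R Y c) Z = s * g p X Z + t * g p Y Z"
    using *[THEN conjunct2, THEN conjunct1] by blast
  show "X \<in> tangent_space A p \<Longrightarrow> (\<And>Y. Y \<in> tangent_space A p \<Longrightarrow> g p X Y = 0) \<Longrightarrow> X = (\<lambda>_. 0)"
    using *[THEN conjunct2, THEN conjunct2] by blast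
qed

lemma linear_metric_tangent_vec:
  assumes "p \<in> topspace M" "c \<in> charts_at A p" "Y \<in> tangent_space A p"
  shows "linear (\<lambda>v. g p (tangent_vec A p c v) Y)"
proof (rule linearI)
  show "g p (tangent_vec A p c (v + w)) Y = g p (tangent_vec A p c v) Y + g p (tangent_vec A p c w) Y" for v w
    using tangent_vec_linear[OF assms(2), of 1 v 1 w] metric_linear_left[OF assms(1) _ _ assms(3), of _ _ 1 1]
      tangent_vec_in[OF assms(2)] by simp
  show "g p (tangent_vec A p c (r *\<^sub>R v)) Y = r *\<^sub>R g p (tangent_vec A p c v) Y" for r v
    using tangent_vec_linear[OF assms(2), of r v 0 v] metric_linear_left[OF assms(1) _ _ assms(3), of _ "tangent_vec A p c v" r 0]
      tangent_vec_in[OF assms(2)] by simp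
qed

lemma metric_coord:
  assumes p: "p \<in> topspace M" and c: "c \<in> charts_at A p"
    and X: "X \<in> tangent_space A p" and Y: "Y \<in> tangent_space A p"
  shows "g p X Y = (\<Sum>i\<in>UNIV. \<Sum>j\<in>UNIV. gcoord A g c (snd c p) $ i $ j * X c $ i * Y c $ j)"
proof -
  let ?e = "\<lambda>i. tangent_vec A p c (axis i 1)"
  have inv: "chart_inv c (snd c p) = p"
    using c chart_inv_left[OF atlas_chart] unfolding charts_at_def by auto
  have expand: "g p Z W = (\<Sum>i\<in>UNIV. Z c $ i * g p (?e i) W)"
    if "Z \<in> tangent_space A p" "W \<in> tangent_space A p" for Z W
    using linear_vec_expansion[OF linear_metric_tangent_vec[OF p c that(2)], of "Z c"]
      tangent_vec_component[OF c that(1)] by simp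
  have "g p X Y = (\<Sum>i\<in>UNIV. X c $ i * g p Y (?e i))"
    using expand[OF X Y] metric_sym[OF p Y tangent_vec_in[OF c]] by simp
  also have "\<dots> = (\<Sum>i\<in>UNIV. \<Sum>j\<in>UNIV. X c $ i * (Y c $ j * g p (?e i) (?e j)))"
    using expand[OF Y tangent_vec_in[OF c]] metric_sym[OF p tangent_vec_in[OF c] tangent_vec_in[OF c]]
    by (simp add: sum_distrib_left)
  also have "\<dots> = (\<Sum>i\<in>UNIV. \<Sum>j\<in>UNIV. gcoord A g c (snd c p) $ i $ j * X c $ i * Y c $ j)"
    by (simp add: gcoord_def inv mult_ac)
  finally show ?thesis .
qed

text \<open>Invertibility of the component matrix is nondegeneracy of the metric: a vector in its kernel is
  the component vector of a tangent vector orthogonal to the whole tangent space.\<close>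

lemma local_metric_gcoord:
  assumes c: "c \<in> A" shows "local_metric (chart_image c) (gcoord A g c)"
proof
  show "open (chart_image c)" using atlas_chart[OF c] unfolding is_chart_def by blast
  show "smooth_on (chart_image c) (\<lambda>x. gcoord A g c x $ i $ j)" for i j
    using semi_riem[unfolded semi_riemannian_manifold_def, THEN conjunct2, THEN conjunct2, THEN conjunct1] c by blast
next
  fix x assume "x \<in> chart_image c"
  then obtain p where p: "p \<in> fst c" "x = snd c p" unfolding chart_image_def by blast
  have top: "p \<in> topspace M"
    using p atlas_chart[OF c] openin_subset unfolding is_chart_def by blast
  have ch: "c \<in> charts_at A p" using c p unfolding charts_at_def by blast
  have inv: "chart_inv c x = p" using chart_inv_left[OF atlas_chart[OF c] p(1)] p(2) by simp
  show sym: "gcoord A g c x $ i $ j = gcoord A g c x $ j $ i" for i j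
    using metric_sym[OF top tangent_vec_in[OF ch] tangent_vec_in[OF ch]]
    by (simp add: gcoord_def inv)
  have ker: "v = 0" if v: "gcoord A g c x *v v = 0" for v
  proof -
    have row: "(gcoord A g c x *v v) $ j = (\<Sum>i\<in>UNIV. gcoord A g c x $ i $ j * v $ i)" for j
      unfolding matrix_vector_mult_def by (simp, intro sum.cong refl arg_cong2[where f = "(*)"] sym)
    have "g p (tangent_vec A p c v) Y = 0" if Y: "Y \<in> tangent_space A p" for Y
    proof -
      have "g p (tangent_vec A p c v) Y = (\<Sum>i\<in>UNIV. \<Sum>j\<in>UNIV. gcoord A g c x $ i $ j * v $ i * Y c $ j)"
        using metric_coord[OF top ch tangent_vec_in[OF ch] Y] tangent_vec_self[OF ch] p(2) by simp
      also have "\<dots> = (\<Sum>j\<in>UNIV. (gcoord A g c x *v v) $ j * Y c $ j)"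
        unfolding row sum_distrib_right by (rule sum.swap)
      finally show ?thesis using v by simp
    qed
    then have "tangent_vec A p c v = (\<lambda>_. 0)"
      by (rule metric_nondegenerate[OF top tangent_vec_in[OF ch]])
    then show "v = 0" using tangent_vec_self[OF ch, of v] by simp
  qed
  show "invertible (gcoord A g c x)"
    unfolding invertible_left_inverse matrix_left_invertible_ker using ker by blast
qed

text \<open>The endomorphism \<open>Z \<mapsto> R(X, Y)Z\<close> is skew-adjoint with respect to \<open>g\<close>. Both sides are expanded in
  the chart in which the curvature is evaluated.\<close>

lemma curvature_skew:
  assumes p: "p \<in> topspace M" and Z: "Z \<in> tangent_space A p" and W: "W \<in> tangent_space A p"
  shows "g p (curvature A g p X Y Z) W = - g p (curvature A g p X Y W) Z"
proof -
  define c where "c = chart_at A p"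
  have c: "c \<in> charts_at A p" unfolding c_def using chart_at_in[OF p] .
  define x where "x = snd c p"
  have x: "x \<in> chart_image c" and cA: "c \<in> A"
    using c unfolding x_def charts_at_def chart_image_def by auto
  interpret local_metric "chart_image c" "gcoord A g c"
    by (rule local_metric_gcoord[OF cA])
  let ?G = "gcoord A g c x" and ?r = "riem_coord (gcoord A g c) x"
  let ?L = "\<lambda>q i j k. \<Sum>l\<in>UNIV. ?G $ q $ l * ?r l i j k"
  have coord: "g p (curvature A g p X Y U) V
      = (\<Sum>i\<in>UNIV. \<Sum>j\<in>UNIV. \<Sum>k\<in>UNIV. \<Sum>q\<in>UNIV. ?L q i j k * X c $ i * Y c $ j * U c $ k * V c $ q)"
    if U: "U \<in> tangent_space A p" and V: "V \<in> tangent_space A p" for U V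
  proof -
    have R: "curvature A g p X Y U c $ l
        = (\<Sum>i\<in>UNIV. \<Sum>j\<in>UNIV. \<Sum>k\<in>UNIV. ?r l i j k * X c $ i * Y c $ j * U c $ k)" for l
      unfolding curvature_def Let_def c_def[symmetric] x_def by (simp add: tangent_vec_self[OF c])
    have "g p (curvature A g p X Y U) V = g p V (curvature A g p X Y U)"
      by (rule metric_sym[OF p curvature_in[OF p] V])
    also have "\<dots> = (\<Sum>q\<in>UNIV. \<Sum>l\<in>UNIV. ?G $ q $ l * V c $ q * curvature A g p X Y U c $ l)"
      unfolding x_def by (rule metric_coord[OF p c V curvature_in[OF p]])
    also have "\<dots> = (\<Sum>q\<in>UNIV. \<Sum>l\<in>UNIV. \<Sum>i\<in>UNIV. \<Sum>j\<in>UNIV. \<Sum>k\<in>UNIV.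
        ?G $ q $ l * ?r l i j k * X c $ i * Y c $ j * U c $ k * V c $ q)"
      unfolding R sum_distrib_left by (intro sum.cong refl) (simp add: mult_ac)
    also have "\<dots> = (\<Sum>q\<in>UNIV. \<Sum>i\<in>UNIV. \<Sum>j\<in>UNIV. \<Sum>k\<in>UNIV. ?L q i j k * X c $ i * Y c $ j * U c $ k * V c $ q)"
      unfolding sum_distrib_right by (intro sum.cong refl sum_rotate3)
    also have "\<dots> = (\<Sum>i\<in>UNIV. \<Sum>j\<in>UNIV. \<Sum>k\<in>UNIV. \<Sum>q\<in>UNIV. ?L q i j k * X c $ i * Y c $ j * U c $ k * V c $ q)"
      by (rule sum_rotate3)
    finally show ?thesis .
  qed
  have "g p (curvature A g p X Y Z) W
      = (\<Sum>i\<in>UNIV. \<Sum>j\<in>UNIV. \<Sum>q\<in>UNIV. \<Sum>k\<in>UNIV. ?L q i j k * X c $ i * Y c $ j * Z c $ k * W c $ q)"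
    unfolding coord[OF Z W] by (intro sum.cong refl sum.swap)
  also have "\<dots> = (\<Sum>i\<in>UNIV. \<Sum>j\<in>UNIV. \<Sum>q\<in>UNIV. \<Sum>k\<in>UNIV. - (?L k i j q * X c $ i * Y c $ j * W c $ q * Z c $ k))"
  proof (intro sum.cong refl)
    fix i j q k
    show "?L q i j k * X c $ i * Y c $ j * Z c $ k * W c $ q = - (?L k i j q * X c $ i * Y c $ j * W c $ q * Z c $ k)"
      unfolding riem_skew[OF x, of q i j k] by simp
  qed
  also have "\<dots> = - g p (curvature A g p X Y W) Z"
    unfolding coord[OF W Z] by (simp add: sum_negf)
  finally show ?thesis .
qed

text \<open>The trace of \<open>V \<mapsto> R(V, X)Z = k (g(X, Z) V - g(V, Z) X)\<close>: the first summand contributes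
  \<open>k n g(X, Z)\<close>, the second \<open>- k g(X, Z)\<close>.\<close>

lemma ricci_nullity:
  assumes p: "p \<in> topspace M" and X: "X \<in> tangent_space A p" and Z: "Z \<in> nullity A g k p"
  shows "ricci A g p X Z = k * (real CARD('n) - 1) * g p X Z"
proof -
  define c where "c = chart_at A p"
  have c: "c \<in> charts_at A p" unfolding c_def using chart_at_in[OF p] .
  have ZT: "Z \<in> tangent_space A p" using Z unfolding nullity_def by (elim CollectE conjE)
  let ?e = "\<lambda>i. tangent_vec A p c (axis i 1)"
  have null: "curvature A g p V X Z = (\<lambda>d. k *\<^sub>R (g p X Z *\<^sub>R V d - g p V Z *\<^sub>R X d))"
    if "V \<in> tangent_space A p" for V
    using CollectD[OF Z[unfolded nullity_def], THEN conjunct2, THEN bspec, OF that, THEN bspec, OF X] .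
  have "ricci A g p X Z = (\<Sum>i\<in>UNIV. curvature A g p (?e i) X Z c $ i)"
    unfolding ricci_def tangent_trace_def Let_def trace_def matrix_def c_def by simp
  also have "\<dots> = (\<Sum>i\<in>UNIV. k * (g p X Z - X c $ i * g p (?e i) Z))"
    by (simp add: null tangent_vec_in[OF c] tangent_vec_self[OF c] mult_ac)
  also have "\<dots> = k * (real CARD('n) * g p X Z - (\<Sum>i\<in>UNIV. X c $ i * g p (?e i) Z))"
    by (simp add: sum_distrib_left[symmetric] sum_subtractf)
  also have "(\<Sum>i\<in>UNIV. X c $ i * g p (?e i) Z) = g p X Z"
    using linear_vec_expansion[OF linear_metric_tangent_vec[OF p c ZT], of "X c"]
      tangent_vec_component[OF c X] by simp
  finally show ?thesis by (simp add: algebra_simps)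
qed

end

section \<open>The Ricci tensor of a semisymmetric manifold\<close>

theorem theorem7p3:
  fixes M :: "'m topology"
    and A :: "('m, 'n::finite) chart set"
    and g :: "('m, 'n) metric"
    and \<xi> :: "'m \<Rightarrow> ('m, 'n) tvec"
    and k :: real
    and a :: "nat \<Rightarrow> real"
  assumes "a 0 + real CARD('n) * a 1 + a 2 + a 3 + a 5 + a 6 \<noteq> 0"
    and "k \<noteq> 0"
    and "Nk_xi_semi_riemannian_manifold M A g k \<xi>"
    and "R_S_T_semisymmetric M A g a"
  shows "\<forall>p\<in>topspace M. \<forall>X\<in>tangent_space A p. \<forall>Y\<in>tangent_space A p.
           ricci A g p X Y = k * (real CARD('n) - 1) * g p X Y"
proof (intro ballI)
  fix p U X
  assume p: "p \<in> topspace M" and U: "U \<in> tangent_space A p" and X: "X \<in> tangent_space A p"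
  have sr: "semi_riemannian_manifold M A g" and unit: "\<bar>g p (\<xi> p) (\<xi> p)\<bar> = 1"
    and null: "\<xi> p \<in> nullity A g k p"
    using assms(3) p unfolding Nk_xi_semi_riemannian_manifold_def by auto
  interpret semi_riemannian M A g
    using sr by unfold_locales (simp_all add: semi_riemannian_manifold_def)
  define \<alpha> where "\<alpha> = a 0 + real CARD('n) * a 1 + a 2 + a 3 + a 5 + a 6"
  define \<beta> where "\<beta> = (a 4 + (real CARD('n) - 1) * a 7) * scalar_curvature A g p"
  define \<kappa> where "\<kappa> = k * (real CARD('n) - 1)"
  define z where "z = \<xi> p"
  define R where "R = curvature A g p X z"
  have z: "z \<in> tangent_space A p" using null unfolding z_def nullity_def by blast
  have R_in: "R V \<in> tangent_space A p" for V unfolding R_def by (rule curvature_in[OF p])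
  have S_T: "S_T A g a p V W = \<alpha> * ricci A g p V W + \<beta> * g p V W" for V W
    unfolding S_T_def \<alpha>_def \<beta>_def by simp
  have ricci_z: "ricci A g p V z = \<kappa> * g p V z" if "V \<in> tangent_space A p" for V
    using ricci_nullity[OF p that null] unfolding \<kappa>_def z_def .
  have Rz: "R z = (\<lambda>c. (k * g p z z) *\<^sub>R X c + (- k * g p X z) *\<^sub>R z c)"
    using null X z unfolding R_def z_def nullity_def by (auto simp: algebra_simps)
  have g_Rz: "g p (R z) U = k * g p z z * g p U X - k * g p X z * g p U z"
    using metric_linear_left[OF p X z U, of "k * g p z z" "- k * g p X z"]
      metric_sym[OF p X U] metric_sym[OF p z U] unfolding Rz by simp
  have g_URz: "g p U (R z) = g p (R z) U" by (rule metric_sym[OF p U R_in])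
  have g_RU: "g p (R U) z = - g p (R z) U"
    unfolding R_def by (rule curvature_skew[OF p U z])
  have ric: "ricci A g p U (R z) = k * g p z z * ricci A g p U X - k * g p X z * (\<kappa> * g p U z)"
    unfolding Rz ricci_linear_right[OF p] ricci_z[OF U] by simp
  have "S_T A g a p (R U) z + S_T A g a p U (R z) = 0"
    using assms(4) p X z U unfolding R_S_T_semisymmetric_def R_def by blast
  \<comment> \<open>By skew-adjointness the terms with \<open>\<beta>\<close> cancel; the multiples of \<open>g p U z\<close> cancel because
     \<open>\<kappa>\<close> is the same factor in both terms.\<close>
  then have "k * g p z z * (\<alpha> * (ricci A g p U X - \<kappa> * g p U X)) = 0"
    unfolding S_T ricci_z[OF R_in] ric g_URz g_RU g_Rz by (simp add: algebra_simps)
  moreover have "g p z z \<noteq> 0" using unit unfolding z_def by auto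
  ultimately have "ricci A g p U X = \<kappa> * g p U X"
    using assms(1,2) unfolding \<alpha>_def by simp
  then show "ricci A g p U X = k * (real CARD('n) - 1) * g p U X" unfolding \<kappa>_def .
qed

end
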